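(* Let $\Lambda_\infty(\alpha)$ be a nuclear power series space of infinite type, $K(b_{n,k})$ a Montel Köthe space, $\theta=(\theta_t)_{t\ge0}$ a scalar sequence and $s_0=\min\{t:\theta_t\ne0\}$. Then $\check T_\theta:\Lambda_\infty(\alpha)\to K(b_{n,k})$ is compact if and only if $\theta\in(\Lambda_\infty(\alpha))'$ and $$\exists m\in\mathbb{N}\ \forall k\in\mathbb{N}\ \exists C>0\ \ \forall n>s_0:\quad b_{n-s_0,k}\le C e^{m\alpha_n}.$$
   Context: $\mathbb{N}=\{1,2,3,\dots\}$. A Köthe matrix is a matrix $(b_{n,k})_{n,k\in\mathbb{N}}$ of non-negative numbers such that for each $n$ there is $k$ with $b_{n,k}>0$, and $b_{n,k}\le b_{n,k+1}$ for all $n,k$. The Köthe space is $K(b_{n,k})=\{x=(x_n)_{n\in\mathbb{N}}:\|x\|_k:=\sum_n|x_n|b_{n,k}<\infty\ \forall k\in\mathbb{N}\}$, a Fréchet space with the seminorms $\|\cdot\|_k$. A Fréchet space is Montel if each bounded set is relatively compact. For $\alpha=(\alpha_n)_{n\in\mathbb{N}}$ non-negative, increasing, with $\alpha_n\to\infty$, the power series space of infinite type $\Lambda_\infty(\alpha)$ is the Köthe space with matrix $(e^{k\alpha_n})_{n,k}$; it is nuclear iff for every $k$ there is $l>k$ with $\sum_ne^{(k-l)\alpha_n}<\infty$. Its dual is identified with $(\Lambda_\infty(\alpha))'=\{y=(y_n)_{n\in\mathbb{N}}:\sup_n|y_n|e^{-k\alpha_n}<\infty\text{ for some }k\in\mathbb{N}\}$.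 $e_n$ is the sequence with $1$ in the $n$-th place and $0$ elsewhere. A linear map $T:E\to F$ of Fréchet spaces is compact if $T(U)$ is precompact in $F$ for some neighborhood $U$ of zero in $E$. For a sequence $\theta=(\theta_0,\theta_1,\theta_2,\dots)$ (regarded as an element of a sequence space indexed by $\mathbb{N}$ by letting its $n$-th coordinate be $\theta_{n-1}$), the operator $\check T_\theta$ given by the upper triangular Toeplitz matrix of $\theta$ is $\check T_\theta e_n=\sum_{j=1}^n\theta_{n-j}e_j$, $\check T_\theta x=\sum_nx_n\check T_\theta e_n$ for $x=\sum_nx_ne_n$; it is well-defined if the series converges in the target space for every $x$ in the domain. Saying that $\check T_\theta$ is compact includes that it is well-defined. Standing assumption: $\theta_t\ne0$ for infinitely many $t$. *)

theory Defs
  imports "HOL-Analysis.Analysis"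
begin

text \<open>
  The index set of the sequence spaces is {1, 2, 3, ...}. A sequence indexed by it is a function
  \<open>x :: nat \<Rightarrow> 'a\<close> with the junk coordinate normalised to \<open>x 0 = 0\<close>; matrices and exponent
  sequences are only ever evaluated at indices at least 1. The scalar field \<open>'a\<close> of sort
  \<open>{real_normed_field, heine_borel}\<close> covers both the real and the complex numbers.
\<close>

definition kothe_matrix :: "(nat \<Rightarrow> nat \<Rightarrow> real) \<Rightarrow> bool" where
  "kothe_matrix b \<longleftrightarrow>
     (\<forall>n\<ge>1. \<forall>k\<ge>1. 0 \<le> b n k) \<and>
     (\<forall>n\<ge>1. \<exists>k\<ge>1. 0 < b n k) \<and>
     (\<forall>n\<ge>1. \<forall>k\<ge>1. b n k \<le> b n (Suc k))"

definition kothe_space ::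
    "(nat \<Rightarrow> nat \<Rightarrow> real) \<Rightarrow> (nat \<Rightarrow> 'a::{real_normed_field,heine_borel}) set" where
  "kothe_space b =
     {x. x 0 = 0 \<and> (\<forall>k\<ge>1. (\<lambda>n. norm (x n) * b n k) summable_on {1..})}"

definition kothe_norm ::
    "(nat \<Rightarrow> nat \<Rightarrow> real) \<Rightarrow> nat \<Rightarrow> (nat \<Rightarrow> 'a::{real_normed_field,heine_borel}) \<Rightarrow> real" where
  "kothe_norm b k x = (\<Sum>\<^sub>\<infinity>n\<in>{1..}. norm (x n) * b n k)"

definition kothe_topology ::
    "(nat \<Rightarrow> nat \<Rightarrow> real) \<Rightarrow> (nat \<Rightarrow> 'a::{real_normed_field,heine_borel}) topology" where
  "kothe_topology b = topology_generated_by
     {{y \<in> kothe_space b. kothe_norm b k (\<lambda>n. y n - x n) < e} | x k e.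
        x \<in> kothe_space b \<and> 1 \<le> k \<and> 0 < e}"

definition kothe_bounded ::
    "(nat \<Rightarrow> nat \<Rightarrow> real) \<Rightarrow> (nat \<Rightarrow> 'a::{real_normed_field,heine_borel}) set \<Rightarrow> bool" where
  "kothe_bounded b B \<longleftrightarrow>
     B \<subseteq> kothe_space b \<and> (\<forall>k\<ge>1. bdd_above (kothe_norm b k ` B))"

text \<open>The type argument fixes the scalar field.\<close>

definition kothe_montel ::
    "'a::{real_normed_field,heine_borel} itself \<Rightarrow> (nat \<Rightarrow> nat \<Rightarrow> real) \<Rightarrow> bool" where
  "kothe_montel _ b \<longleftrightarrow>
     (\<forall>B :: (nat \<Rightarrow> 'a) set. kothe_bounded b B \<longrightarrow>
        compactin (kothe_topology b) (kothe_topology b closure_of B))"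

text \<open>Precompact (totally bounded): for every zero neighbourhood \<open>V\<close>, the set \<open>S\<close> is covered by
  finitely many translates of \<open>V\<close>.\<close>

definition kothe_precompact ::
    "(nat \<Rightarrow> nat \<Rightarrow> real) \<Rightarrow> (nat \<Rightarrow> 'a::{real_normed_field,heine_borel}) set \<Rightarrow> bool" where
  "kothe_precompact b S \<longleftrightarrow>
     S \<subseteq> kothe_space b \<and>
     (\<forall>V. openin (kothe_topology b) V \<and> (\<lambda>_. 0) \<in> V \<longrightarrow>
        (\<exists>F. finite F \<and> F \<subseteq> kothe_space b \<and> S \<subseteq> (\<Union>x\<in>F. {\<lambda>n. x n + v n | v. v \<in> V})))"

definition kothe_compact_map ::
    "(nat \<Rightarrow> nat \<Rightarrow> real) \<Rightarrow> (nat \<Rightarrow> nat \<Rightarrow> real) \<Rightarrow>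
     ((nat \<Rightarrow> 'a::{real_normed_field,heine_borel}) \<Rightarrow> (nat \<Rightarrow> 'a)) \<Rightarrow> bool" where
  "kothe_compact_map a b T \<longleftrightarrow>
     T ` kothe_space a \<subseteq> kothe_space b \<and>
     (\<exists>U. openin (kothe_topology a) U \<and> (\<lambda>_. 0) \<in> U \<and> kothe_precompact b (T ` U))"

definition exponent_seq :: "(nat \<Rightarrow> real) \<Rightarrow> bool" where
  "exponent_seq \<alpha> \<longleftrightarrow>
     (\<forall>n\<ge>1. 0 \<le> \<alpha> n) \<and> (\<forall>n\<ge>1. \<alpha> n \<le> \<alpha> (Suc n)) \<and> filterlim \<alpha> at_top sequentially"

definition power_series_matrix :: "(nat \<Rightarrow> real) \<Rightarrow> nat \<Rightarrow> nat \<Rightarrow> real" where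
  "power_series_matrix \<alpha> n k = exp (real k * \<alpha> n)"

text \<open>Nuclearity of the power series space of infinite type, as given by the
  Grothendieck--Pietsch criterion.\<close>

definition power_series_nuclear :: "(nat \<Rightarrow> real) \<Rightarrow> bool" where
  "power_series_nuclear \<alpha> \<longleftrightarrow>
     (\<forall>k\<ge>1. \<exists>l>k. (\<lambda>n. exp ((real k - real l) * \<alpha> n)) summable_on {1..})"

text \<open>The dual of the power series space, identified with a sequence space.\<close>

definition power_series_dual ::
    "(nat \<Rightarrow> real) \<Rightarrow> (nat \<Rightarrow> 'a::{real_normed_field,heine_borel}) set" where
  "power_series_dual \<alpha> =
     {y. y 0 = 0 \<and>
         (\<exists>k\<ge>1. bdd_above ((\<lambda>n. norm (y n) * exp (- (real k * \<alpha> n))) ` {1..}))}"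

text \<open>A sequence indexed by {0, 1, 2, ...} viewed as one indexed by {1, 2, 3, ...}.\<close>

definition shift_index :: "(nat \<Rightarrow> 'a::zero) \<Rightarrow> nat \<Rightarrow> 'a" where
  "shift_index \<theta> n = (if n = 0 then 0 else \<theta> (n - 1))"

definition unit_seq :: "nat \<Rightarrow> nat \<Rightarrow> 'a::zero_neq_one" where
  "unit_seq n = (\<lambda>i. if i = n then 1 else 0)"

definition toeplitz_column ::
    "(nat \<Rightarrow> 'a::{real_normed_field,heine_borel}) \<Rightarrow> nat \<Rightarrow> (nat \<Rightarrow> 'a)" where
  "toeplitz_column \<theta> n = (\<lambda>i. \<Sum>j=1..n. \<theta> (n - j) * unit_seq j i)"

text \<open>\<open>toeplitz_sums b \<theta> x y\<close>: the series of the \<open>x n\<close>-multiples of the columns converges to \<open>y\<close>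
  in the topology of the target space (which includes that \<open>y\<close> lies in that space).\<close>

definition toeplitz_sums ::
    "(nat \<Rightarrow> nat \<Rightarrow> real) \<Rightarrow> (nat \<Rightarrow> 'a::{real_normed_field,heine_borel}) \<Rightarrow>
     (nat \<Rightarrow> 'a) \<Rightarrow> (nat \<Rightarrow> 'a) \<Rightarrow> bool" where
  "toeplitz_sums b \<theta> x y \<longleftrightarrow>
     limitin (kothe_topology b) (\<lambda>N i. \<Sum>n=1..N. x n * toeplitz_column \<theta> n i) y sequentially"

text \<open>The limit is unique when \<open>b\<close> is a Koethe matrix, as the topology is then Hausdorff.\<close>

definition toeplitz_op ::
    "(nat \<Rightarrow> nat \<Rightarrow> real) \<Rightarrow> (nat \<Rightarrow> 'a::{real_normed_field,heine_borel}) \<Rightarrow>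
     (nat \<Rightarrow> 'a) \<Rightarrow> (nat \<Rightarrow> 'a)" where
  "toeplitz_op b \<theta> x = (THE y. toeplitz_sums b \<theta> x y)"

definition toeplitz_well_defined ::
    "(nat \<Rightarrow> nat \<Rightarrow> real) \<Rightarrow> (nat \<Rightarrow> nat \<Rightarrow> real) \<Rightarrow>
     (nat \<Rightarrow> 'a::{real_normed_field,heine_borel}) \<Rightarrow> bool" where
  "toeplitz_well_defined a b \<theta> \<longleftrightarrow> (\<forall>x\<in>kothe_space a. \<exists>y. toeplitz_sums b \<theta> x y)"

definition toeplitz_compact ::
    "(nat \<Rightarrow> nat \<Rightarrow> real) \<Rightarrow> (nat \<Rightarrow> nat \<Rightarrow> real) \<Rightarrow>
     (nat \<Rightarrow> 'a::{real_normed_field,heine_borel}) \<Rightarrow> bool" where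
  "toeplitz_compact a b \<theta> \<longleftrightarrow>
     toeplitz_well_defined a b \<theta> \<and> kothe_compact_map a b (toeplitz_op b \<theta>)"

end

theory Submission
  imports Defs
begin

text \<open>
  Everything reduces to the growth of the columns: for a Montel target, the operator is compact
  if and only if some single \<open>m\<close> satisfies \<open>\<forall>k. \<exists>C. \<forall>n. \<parallel>T e\<^sub>n\<parallel>\<^sub>k \<le> C e\<^bsup>m \<alpha>\<^sub>n\<^esup>\<close>.

  If \<open>T\<close> maps a neighbourhood \<open>{x. \<parallel>x\<parallel>\<^sub>m < e}\<close> to a precompact set, the image is bounded in every
  seminorm, and testing this on multiples of the unit vectors gives the column estimates
  (\<open>toeplitz_column_bound_of_compact\<close>). Conversely, the column estimates make the series
  \<open>\<Sum>\<^sub>n x\<^sub>n T e\<^sub>n\<close> converge absolutely in every seminorm, hence converge, with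
  \<open>\<parallel>T x\<parallel>\<^sub>k \<le> C\<^sub>k \<parallel>x\<parallel>\<^sub>m\<close>; as \<open>m\<close> does not depend on \<open>k\<close>, the unit ball of the \<open>m\<close>-th seminorm has a
  bounded image, and bounded sets are precompact in a Montel space
  (\<open>toeplitz_compact_of_column_bound\<close>).

  It remains to compare the column estimates with the two conditions of the theorem, using
  \<open>\<parallel>T e\<^sub>n\<parallel>\<^sub>k = \<Sum>\<^sub>j |\<theta>\<^sub>n\<^sub>-\<^sub>j| b\<^sub>j\<^sub>,\<^sub>k\<close> where \<open>j\<close> runs from 1 to \<open>n\<close>. The term \<open>j = n - s\<^sub>0\<close> of this sum yields
  the condition on \<open>b\<close>, and the term \<open>j = 1\<close> yields that \<open>\<theta>\<close> is in the dual. In the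
  other direction only the terms with \<open>j \<le> n - s\<^sub>0\<close> survive, so there are at most \<open>n\<close> of them, and
  monotonicity of \<open>\<alpha>\<close> bounds each of them by a constant times \<open>e\<^bsup>(p + m) \<alpha>\<^sub>n\<^esup>\<close>. The factor \<open>n\<close> is
  absorbed by nuclearity, which forces \<open>n \<le> S e\<^bsup>q \<alpha>\<^sub>n\<^esup>\<close> for some \<open>q\<close> and \<open>S\<close>
  (\<open>index_le_exp_of_nuclear\<close>).
\<close>

section \<open>Seminorms of a Koethe space\<close>

lemma kothe_weight_nonneg: "kothe_matrix b \<Longrightarrow> 1 \<le> n \<Longrightarrow> 1 \<le> k \<Longrightarrow> 0 \<le> b n k"
  by (simp add: kothe_matrix_def)

lemma kothe_weight_pos: "kothe_matrix b \<Longrightarrow> 1 \<le> n \<Longrightarrow> \<exists>k\<ge>1. 0 < b n k"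
  by (simp add: kothe_matrix_def)

lemma kothe_weight_mono:
  assumes "kothe_matrix b" "1 \<le> n" "1 \<le> k" "k \<le> l"
  shows "b n k \<le> b n l"
  using assms(4)
proof (induction l rule: dec_induct)
  case (step l)
  then have "b n l \<le> b n (Suc l)" using assms by (simp add: kothe_matrix_def)
  with step.IH show ?case by linarith
qed simp

lemma kothe_norm_nonneg: "kothe_matrix b \<Longrightarrow> 1 \<le> k \<Longrightarrow> 0 \<le> kothe_norm b k x"
  unfolding kothe_norm_def by (intro infsum_nonneg) (simp add: kothe_weight_nonneg[of b])

text \<open>Together with the lemma after it, this reduces every question about the infinite sum defining
  a seminorm to its finite partial sums.\<close>

lemma partial_sum_le_kothe_norm:
  assumes "kothe_matrix b" "x \<in> kothe_space b" "1 \<le> k"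
  shows "(\<Sum>i=1..N. norm (x i) * b i k) \<le> kothe_norm b k x"
  unfolding kothe_norm_def
  using assms by (intro finite_sum_le_infsum) (auto simp: kothe_space_def kothe_weight_nonneg[OF assms(1)])

lemma kothe_norm_le_of_partial_sums:
  assumes b: "kothe_matrix b" and k: "1 \<le> k"
    and le: "\<And>N. (\<Sum>i=1..N. norm (x i) * b i k) \<le> B"
  shows "(\<lambda>i. norm (x i) * b i k) summable_on {1..}" and "kothe_norm b k x \<le> B"
proof -
  have fin: "(\<Sum>i\<in>F. norm (x i) * b i k) \<le> B" if "finite F" "F \<subseteq> {1..}" for F
  proof -
    have "F \<subseteq> {1..Max F}" using that by (auto simp: Max_ge)
    then have "(\<Sum>i\<in>F. norm (x i) * b i k) \<le> (\<Sum>i=1..Max F. norm (x i) * b i k)"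
      using k by (intro sum_mono2) (auto simp: kothe_weight_nonneg[OF b])
    with le show ?thesis by (meson order_trans)
  qed
  show summ: "(\<lambda>i. norm (x i) * b i k) summable_on {1..}"
    using fin k by (intro nonneg_bdd_above_summable_on bdd_aboveI)
      (auto simp: kothe_weight_nonneg[OF b])
  show "kothe_norm b k x \<le> B"
    unfolding kothe_norm_def using fin by (intro infsum_le_finite_sums[OF summ]) auto
qed

lemma coordinate_le_kothe_norm:
  assumes "kothe_matrix b" "x \<in> kothe_space b" "1 \<le> k" "1 \<le> i"
  shows "norm (x i) * b i k \<le> kothe_norm b k x"
proof -
  have "norm (x i) * b i k \<le> (\<Sum>i=1..i. norm (x i) * b i k)"
    using assms by (intro member_le_sum) (auto simp: kothe_weight_nonneg[OF assms(1)])
  with partial_sum_le_kothe_norm[OF assms(1-3)] show ?thesis by (meson order_trans)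
qed

lemma finite_support_in_kothe_space:
  assumes "\<And>i. i \<notin> {1..n} \<Longrightarrow> x i = 0"
  shows "x \<in> kothe_space b" and "kothe_norm b k x = (\<Sum>i=1..n. norm (x i) * b i k)"
proof -
  have "(\<lambda>i. norm (x i) * b i k) summable_on {1..}" for k
  proof -
    have "(\<lambda>i. norm (x i) * b i k) summable_on {1..n}
        \<longleftrightarrow> (\<lambda>i. norm (x i) * b i k) summable_on {1..}"
      by (rule summable_on_cong_neutral) (use assms in auto)
    then show ?thesis by simp
  qed
  then show "x \<in> kothe_space b" using assms by (simp add: kothe_space_def)
  have "kothe_norm b k x = (\<Sum>\<^sub>\<infinity>i\<in>{1..n}. norm (x i) * b i k)"
    unfolding kothe_norm_def by (rule infsum_cong_neutral) (use assms in auto)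
  then show "kothe_norm b k x = (\<Sum>i=1..n. norm (x i) * b i k)" by simp
qed

lemma kothe_zero: "(\<lambda>_. 0) \<in> kothe_space b" "kothe_norm b k (\<lambda>_. 0) = 0"
  by (simp_all add: kothe_space_def kothe_norm_def)

lemma kothe_add:
  assumes b: "kothe_matrix b" and x: "x \<in> kothe_space b" and y: "y \<in> kothe_space b"
  shows "(\<lambda>n. x n + y n) \<in> kothe_space b"
    and "1 \<le> k \<Longrightarrow> kothe_norm b k (\<lambda>n. x n + y n) \<le> kothe_norm b k x + kothe_norm b k y"
proof -
  have le: "(\<Sum>i=1..N. norm (x i + y i) * b i k) \<le> kothe_norm b k x + kothe_norm b k y"
    if k: "1 \<le> k" for k N
  proof -
    have "(\<Sum>i=1..N. norm (x i + y i) * b i k)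
        \<le> (\<Sum>i=1..N. norm (x i) * b i k + norm (y i) * b i k)"
      unfolding distrib_right[symmetric]
      by (intro sum_mono mult_right_mono norm_triangle_ineq kothe_weight_nonneg[OF b _ k]) simp
    also have "\<dots> \<le> kothe_norm b k x + kothe_norm b k y"
      using partial_sum_le_kothe_norm[OF b x k, of N] partial_sum_le_kothe_norm[OF b y k, of N]
      by (simp add: sum.distrib)
    finally show ?thesis .
  qed
  show "(\<lambda>n. x n + y n) \<in> kothe_space b"
    using x y kothe_norm_le_of_partial_sums(1)[OF b _ le] unfolding kothe_space_def by simp
  show "1 \<le> k \<Longrightarrow> kothe_norm b k (\<lambda>n. x n + y n) \<le> kothe_norm b k x + kothe_norm b k y"
    by (rule kothe_norm_le_of_partial_sums(2)[OF b _ le])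
qed

lemma kothe_scale:
  assumes "x \<in> kothe_space b"
  shows "(\<lambda>n. c * x n) \<in> kothe_space b"
    and "kothe_norm b k (\<lambda>n. c * x n) = norm c * kothe_norm b k x"
proof -
  have eq: "norm (c * x n) * b n k = norm c * (norm (x n) * b n k)" for n k
    by (simp add: norm_mult)
  show "(\<lambda>n. c * x n) \<in> kothe_space b"
    using assms by (simp add: kothe_space_def eq summable_on_cmult_right)
  show "kothe_norm b k (\<lambda>n. c * x n) = norm c * kothe_norm b k x"
    unfolding kothe_norm_def eq by (rule infsum_cmult_right')
qed

lemma kothe_diff:
  assumes b: "kothe_matrix b" and x: "x \<in> kothe_space b" and y: "y \<in> kothe_space b"
  shows "(\<lambda>n. x n - y n) \<in> kothe_space b"
  using kothe_add(1)[OF b x kothe_scale(1)[OF y, of "-1"]] by simp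

lemma kothe_norm_triangle_diff:
  assumes b: "kothe_matrix b" and "x \<in> kothe_space b" "y \<in> kothe_space b" "z \<in> kothe_space b"
    and k: "1 \<le> k"
  shows "kothe_norm b k (\<lambda>n. x n - z n)
      \<le> kothe_norm b k (\<lambda>n. x n - y n) + kothe_norm b k (\<lambda>n. y n - z n)"
  using kothe_add(2)[OF b kothe_diff[OF b assms(2,3)] kothe_diff[OF b assms(3,4)] k] by simp

lemma kothe_norm_minus_commute:
  "kothe_norm b k (\<lambda>n. x n - y n) = kothe_norm b k (\<lambda>n. y n - x n)"
  by (simp add: kothe_norm_def norm_minus_commute)

lemma kothe_norm_mono:
  assumes b: "kothe_matrix b" and x: "x \<in> kothe_space b" and "1 \<le> k" "k \<le> l"
  shows "kothe_norm b k x \<le> kothe_norm b l x"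
  unfolding kothe_norm_def
proof (rule infsum_mono)
  show "(\<lambda>n. norm (x n) * b n k) summable_on {1..}" "(\<lambda>n. norm (x n) * b n l) summable_on {1..}"
    using assms by (simp_all add: kothe_space_def)
  show "norm (x n) * b n k \<le> norm (x n) * b n l" if "n \<in> {1..}" for n
    using that assms by (intro mult_left_mono kothe_weight_mono[OF b]) auto
qed

lemma kothe_sum:
  assumes b: "kothe_matrix b" and f: "\<And>n. n \<in> A \<Longrightarrow> f n \<in> kothe_space b"
  shows "(\<lambda>i. \<Sum>n\<in>A. f n i) \<in> kothe_space b"
    and "1 \<le> k \<Longrightarrow> kothe_norm b k (\<lambda>i. \<Sum>n\<in>A. f n i) \<le> (\<Sum>n\<in>A. kothe_norm b k (f n))"
proof -
  have "(\<lambda>i. \<Sum>n\<in>A. f n i) \<in> kothe_space b \<and>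
      (1 \<le> k \<longrightarrow> kothe_norm b k (\<lambda>i. \<Sum>n\<in>A. f n i) \<le> (\<Sum>n\<in>A. kothe_norm b k (f n)))"
    using f
  proof (induction A rule: infinite_finite_induct)
    case (insert a A)
    then have "f a \<in> kothe_space b" "(\<lambda>i. \<Sum>n\<in>A. f n i) \<in> kothe_space b" by auto
    with kothe_add(1)[OF b this] kothe_add(2)[OF b this, of k] insert show ?case by auto
  qed (simp_all add: kothe_zero)
  then show "(\<lambda>i. \<Sum>n\<in>A. f n i) \<in> kothe_space b"
    and "1 \<le> k \<Longrightarrow> kothe_norm b k (\<lambda>i. \<Sum>n\<in>A. f n i) \<le> (\<Sum>n\<in>A. kothe_norm b k (f n))"
    by auto
qed

lemma kothe_norm_zero_imp_eq:
  assumes b: "kothe_matrix b" and x: "x \<in> kothe_space b" and y: "y \<in> kothe_space b"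
    and zero: "\<And>k. 1 \<le> k \<Longrightarrow> kothe_norm b k (\<lambda>n. x n - y n) \<le> 0"
  shows "x = y"
proof
  fix i
  show "x i = y i"
  proof (cases "i = 0")
    case True
    then show ?thesis using x y by (simp add: kothe_space_def)
  next
    case False
    then obtain k where k: "1 \<le> k" "0 < b i k" using kothe_weight_pos[OF b, of i] by auto
    have "norm (x i - y i) * b i k \<le> 0"
      using coordinate_le_kothe_norm[OF b kothe_diff[OF b x y] k(1), of i] zero[OF k(1)] False by simp
    then show ?thesis using k by (simp add: mult_le_0_iff)
  qed
qed

section \<open>The topology of a Koethe space\<close>

definition kothe_ball where
  "kothe_ball b x k e = {y \<in> kothe_space b. kothe_norm b k (\<lambda>n. y n - x n) < e}"

lemma openin_kothe_ball:
  "x \<in> kothe_space b \<Longrightarrow> 1 \<le> k \<Longrightarrow> 0 < e \<Longrightarrow> openin (kothe_topology b) (kothe_ball b x k e)"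
  unfolding kothe_topology_def kothe_ball_def
  by (rule topology_generated_by_Basis) blast

lemma centre_in_kothe_ball: "x \<in> kothe_space b \<Longrightarrow> 0 < e \<Longrightarrow> x \<in> kothe_ball b x k e"
  by (simp add: kothe_ball_def kothe_zero)

lemma topspace_kothe: "topspace (kothe_topology b) = kothe_space b"
proof
  show "topspace (kothe_topology b) \<subseteq> kothe_space b"
    by (auto simp: kothe_topology_def topology_generated_by_topspace)
  show "kothe_space b \<subseteq> topspace (kothe_topology b)"
  proof
    fix x assume "x \<in> kothe_space b"
    then show "x \<in> topspace (kothe_topology b)"
      using openin_subset[OF openin_kothe_ball[of x b 1 1]] centre_in_kothe_ball[of x b 1 1] by auto
  qed
qed

text \<open>The balls only form a subbase by definition. That a single ball around each point
  suffices rests on the seminorms increasing with \<open>k\<close>.\<close>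

lemma openin_kothe_contains_ball:
  assumes b: "kothe_matrix b" and "openin (kothe_topology b) U" "y \<in> U"
  shows "\<exists>k\<ge>1. \<exists>e>0. kothe_ball b y k e \<subseteq> U"
proof -
  have "generate_topology_on
      {{y \<in> kothe_space b. kothe_norm b k (\<lambda>n. y n - x n) < e} | x k e.
        x \<in> kothe_space b \<and> 1 \<le> k \<and> 0 < e} U"
    using assms(2) by (simp add: kothe_topology_def openin_topology_generated_by_iff)
  then show ?thesis using assms(3)
  proof (induction arbitrary: y)
    case (Int U V)
    obtain k e where k: "1 \<le> k" "0 < e" "kothe_ball b y k e \<subseteq> U" using Int by blast
    obtain l d where l: "1 \<le> l" "0 < d" "kothe_ball b y l d \<subseteq> V" using Int by blast
    have y: "y \<in> kothe_space b"
      using Int.hyps(1) Int.prems openin_subset[of "kothe_topology b" U]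
      by (auto simp: kothe_topology_def openin_topology_generated_by_iff topspace_kothe[unfolded kothe_topology_def])
    have "kothe_ball b y (max k l) (min e d) \<subseteq> U \<inter> V"
    proof
      fix z assume z: "z \<in> kothe_ball b y (max k l) (min e d)"
      then have zy: "(\<lambda>n. z n - y n) \<in> kothe_space b"
        using kothe_diff[OF b _ y] by (simp add: kothe_ball_def)
      have "z \<in> kothe_ball b y k e" "z \<in> kothe_ball b y l d"
        using z kothe_norm_mono[OF b zy k(1), of "max k l"] kothe_norm_mono[OF b zy l(1), of "max k l"]
        by (auto simp: kothe_ball_def)
      with k l show "z \<in> U \<inter> V" by blast
    qed
    then show ?case using k l by (intro exI[of _ "max k l"]) (auto intro!: exI[of _ "min e d"])
  next
    case (UN K)
    then obtain W where "W \<in> K" "y \<in> W" by blast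
    with UN.IH show ?case by (meson Union_upper order_trans)
  next
    case (Basis s)
    then obtain x k e where s: "s = {y \<in> kothe_space b. kothe_norm b k (\<lambda>n. y n - x n) < e}"
      and x: "x \<in> kothe_space b" and k: "1 \<le> k" by blast
    have y: "y \<in> kothe_space b" and ye: "kothe_norm b k (\<lambda>n. y n - x n) < e"
      using Basis s by auto
    have "kothe_ball b y k (e - kothe_norm b k (\<lambda>n. y n - x n)) \<subseteq> s"
    proof
      fix z assume z: "z \<in> kothe_ball b y k (e - kothe_norm b k (\<lambda>n. y n - x n))"
      then have "z \<in> kothe_space b" by (simp add: kothe_ball_def)
      then show "z \<in> s"
        using z kothe_norm_triangle_diff[OF b _ y x k, of z] by (simp add: kothe_ball_def s)
    qed
    with ye k show ?case by (intro exI[of _ k] conjI exI[of _ "e - kothe_norm b k (\<lambda>n. y n - x n)"]) auto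
  qed simp
qed

lemma limitin_kothe_iff:
  assumes b: "kothe_matrix b" and s: "\<And>N. s N \<in> kothe_space b"
  shows "limitin (kothe_topology b) s y F \<longleftrightarrow>
    y \<in> kothe_space b \<and> (\<forall>k\<ge>1. ((\<lambda>N. kothe_norm b k (\<lambda>n. s N n - y n)) \<longlongrightarrow> 0) F)"
    (is "?L \<longleftrightarrow> ?R")
proof
  assume L: ?L
  then have y: "y \<in> kothe_space b" by (simp add: limitin_def topspace_kothe)
  moreover have "((\<lambda>N. kothe_norm b k (\<lambda>n. s N n - y n)) \<longlongrightarrow> 0) F" if k: "1 \<le> k" for k
  proof (rule tendstoI)
    fix e :: real assume e: "0 < e"
    have "\<forall>\<^sub>F N in F. s N \<in> kothe_ball b y k e"
      using L openin_kothe_ball[OF y k e] centre_in_kothe_ball[OF y e] by (auto simp: limitin_def)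
    then show "\<forall>\<^sub>F N in F. dist (kothe_norm b k (\<lambda>n. s N n - y n)) 0 < e"
      by (rule eventually_mono) (simp add: kothe_ball_def kothe_norm_nonneg[OF b k])
  qed
  ultimately show ?R by blast
next
  assume R: ?R
  show ?L unfolding limitin_def
  proof (intro conjI allI impI)
    show "y \<in> topspace (kothe_topology b)" using R by (simp add: topspace_kothe)
    fix U assume "openin (kothe_topology b) U \<and> y \<in> U"
    then obtain k e where k: "1 \<le> k" "0 < e" "kothe_ball b y k e \<subseteq> U"
      using openin_kothe_contains_ball[OF b] by blast
    have "\<forall>\<^sub>F N in F. kothe_norm b k (\<lambda>n. s N n - y n) < e"
      using R k by (auto dest: order_tendstoD(2))
    then show "\<forall>\<^sub>F N in F. s N \<in> U"
      by (rule eventually_mono) (use k s in \<open>auto simp: kothe_ball_def\<close>)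
  qed
qed

lemma kothe_limit_unique:
  assumes b: "kothe_matrix b" and s: "\<And>N. s N \<in> kothe_space b"
    and F: "F \<noteq> bot"
    and x: "limitin (kothe_topology b) s x F" and y: "limitin (kothe_topology b) s y F"
  shows "x = y"
proof -
  have xK: "x \<in> kothe_space b" and yK: "y \<in> kothe_space b"
    using x y by (simp_all add: limitin_def topspace_kothe)
  show ?thesis
  proof (rule kothe_norm_zero_imp_eq[OF b xK yK])
    fix k :: nat assume k: "1 \<le> k"
    have "((\<lambda>N. kothe_norm b k (\<lambda>n. s N n - x n) + kothe_norm b k (\<lambda>n. s N n - y n)) \<longlongrightarrow> 0 + 0) F"
      using x y k by (intro tendsto_add) (auto simp: limitin_kothe_iff[OF b s])
    moreover have "kothe_norm b k (\<lambda>n. x n - y n)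
        \<le> kothe_norm b k (\<lambda>n. s N n - x n) + kothe_norm b k (\<lambda>n. s N n - y n)" for N
      using kothe_norm_triangle_diff[OF b xK s yK k, of N] kothe_norm_minus_commute[of b k x "s N"]
      by simp
    ultimately show "kothe_norm b k (\<lambda>n. x n - y n) \<le> 0"
      using tendsto_lowerbound[OF _ always_eventually F] by (metis (no_types, lifting) add_0)
  qed
qed

text \<open>Completeness of the Koethe space, in the form of convergence of absolutely convergent series.
  The coordinates of the partial sums are Cauchy, since each coordinate is controlled by a seminorm
  whose weight is positive there; tail estimates hold for all finite sections of the limit.\<close>

lemma kothe_series_convergent:
  fixes f :: "nat \<Rightarrow> nat \<Rightarrow> 'a::{real_normed_field,heine_borel}"
  assumes b: "kothe_matrix b" and f: "\<And>n. f n \<in> kothe_space b"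
    and bound: "\<And>k N. 1 \<le> k \<Longrightarrow> (\<Sum>n=1..N. kothe_norm b k (f n)) \<le> B k"
  shows "\<exists>y. limitin (kothe_topology b) (\<lambda>N i. \<Sum>n=1..N. f n i) y sequentially \<and>
    (\<forall>k\<ge>1. kothe_norm b k y \<le> B k)"
proof -
  define S where "S N i = (\<Sum>n=1..N. f n i)" for N i
  define G where "G k N = (\<Sum>n=1..N. kothe_norm b k (f n))" for k N
  define L where "L k = lim (G k)" for k
  have S: "S N \<in> kothe_space b" for N
    unfolding S_def using kothe_sum(1)[OF b f] by simp
  have mono: "incseq (G k)" if "1 \<le> k" for k
    unfolding G_def using that by (intro incseq_SucI) (simp add: kothe_norm_nonneg[OF b])
  have lim: "G k \<longlonglongrightarrow> L k" and GL: "G k N \<le> L k" and LB: "L k \<le> B k" if k: "1 \<le> k" for k N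
  proof -
    obtain l where l: "G k \<longlonglongrightarrow> l" and "\<forall>N. G k N \<le> l"
      using incseq_convergent[OF mono[OF k], of "B k"] bound[OF k] by (auto simp: G_def)
    then show "G k \<longlonglongrightarrow> L k" "G k N \<le> L k" by (simp_all add: L_def limI)
    then show "L k \<le> B k" using bound[OF k] LIMSEQ_le_const2[of "G k" "L k" "B k"]
      by (auto simp: G_def)
  qed
  have SG: "kothe_norm b k (\<lambda>i. S Q i - S P i) \<le> G k Q - G k P" if k: "1 \<le> k" and "P \<le> Q" for k P Q
  proof -
    have tail_set: "{P<..Q} = {1..Q} - {1..P}" and sub: "{1..P} \<subseteq> {1..Q}"
      using \<open>P \<le> Q\<close> by auto
    have "(\<lambda>i. S Q i - S P i) = (\<lambda>i. \<Sum>n\<in>{P<..Q}. f n i)"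
      unfolding S_def tail_set by (intro ext sum_diff[symmetric] sub) simp
    moreover have "G k Q - G k P = (\<Sum>n\<in>{P<..Q}. kothe_norm b k (f n))"
      unfolding G_def tail_set by (intro sum_diff[symmetric] sub) simp
    ultimately show ?thesis using kothe_sum(2)[where A = "{P<..Q}" and f = f, OF b f k] by simp
  qed
  have "convergent (\<lambda>N. S N i)" for i
  proof (cases "i = 0")
    case True
    then have "S N i = 0" for N using S[of N] by (simp add: kothe_space_def)
    then show ?thesis by (simp add: convergent_const)
  next
    case False
    then obtain k where k: "1 \<le> k" "0 < b i k" using kothe_weight_pos[OF b, of i] by auto
    have coord: "norm (S Q i - S P i) * b i k \<le> G k Q - G k P" if "P \<le> Q" for P Q
      using coordinate_le_kothe_norm[OF b kothe_diff[OF b S[of Q] S[of P]] k(1), of i]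
        SG[OF k(1) that] False by simp
    have "Cauchy (\<lambda>N. S N i)"
    proof (rule CauchyI')
      fix e :: real assume "0 < e"
      then have "0 < e * b i k" using k by simp
      then obtain M where M: "\<And>m n. m \<ge> M \<Longrightarrow> n \<ge> M \<Longrightarrow> \<bar>G k m - G k n\<bar> < e * b i k"
        using LIMSEQ_imp_Cauchy[OF lim[OF k(1)]] unfolding Cauchy_def dist_real_def by blast
      have "norm (S m i - S n i) < e" if "M \<le> m" "m < n" for m n
      proof -
        have "norm (S n i - S m i) * b i k < e * b i k"
          using coord[of m n] M[of n m] that by fastforce
        then show ?thesis using k by (simp add: norm_minus_commute)
      qed
      then show "\<exists>M. \<forall>m\<ge>M. \<forall>n>m. dist (S m i) (S n i) < e" by (auto simp: dist_norm)
    qed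
    then show ?thesis by (rule Cauchy_convergent)
  qed
  then have "\<forall>i. \<exists>l. (\<lambda>N. S N i) \<longlonglongrightarrow> l" by (simp add: convergent_def)
  then obtain y where y: "\<And>i. (\<lambda>N. S N i) \<longlonglongrightarrow> y i" by metis
  \<comment> \<open>For fixed \<open>N\<close> only finitely many coordinates occur, so coordinatewise convergence suffices to
    let \<open>Q\<close> tend to infinity in the estimate \<open>SG\<close>.\<close>
  have tail: "(\<Sum>i=1..N. norm (y i - S P i) * b i k) \<le> L k - G k P" if k: "1 \<le> k" for k N P
  proof (rule LIMSEQ_le_const2)
    show "(\<lambda>Q. \<Sum>i=1..N. norm (S Q i - S P i) * b i k) \<longlonglongrightarrow> (\<Sum>i=1..N. norm (y i - S P i) * b i k)"
      by (intro tendsto_intros y)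
    have "(\<Sum>i=1..N. norm (S Q i - S P i) * b i k) \<le> L k - G k P" if "P \<le> Q" for Q
      using partial_sum_le_kothe_norm[OF b kothe_diff[OF b S[of Q] S[of P]] k, of N]
        SG[OF k that] GL[OF k, of Q] by linarith
    then show "\<exists>M. \<forall>Q\<ge>M. (\<Sum>i=1..N. norm (S Q i - S P i) * b i k) \<le> L k - G k P" by blast
  qed
  have "(\<lambda>N. S N 0) \<longlonglongrightarrow> 0" using S by (simp add: kothe_space_def)
  then have y0: "y 0 = 0" using y LIMSEQ_unique by blast
  have S0: "S 0 i = 0" and G0: "G k 0 = 0" for i k by (simp_all add: S_def G_def)
  have yK: "y \<in> kothe_space b"
    using kothe_norm_le_of_partial_sums(1)[OF b _ tail[where P = 0, unfolded S0 diff_zero]] y0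
    by (simp add: kothe_space_def)
  have "kothe_norm b k y \<le> B k" if k: "1 \<le> k" for k
    using kothe_norm_le_of_partial_sums(2)[OF b k tail[OF k, where P = 0, unfolded S0 G0 diff_zero]]
      LB[OF k] by linarith
  moreover have "limitin (kothe_topology b) S y sequentially"
    unfolding limitin_kothe_iff[OF b S]
  proof (intro conjI allI impI yK)
    fix k :: nat assume k: "1 \<le> k"
    have "(\<lambda>P. L k - G k P) \<longlonglongrightarrow> L k - L k" by (intro tendsto_intros lim[OF k])
    then have L0: "(\<lambda>P. L k - G k P) \<longlonglongrightarrow> 0" by simp
    have "kothe_norm b k (\<lambda>n. S P n - y n) \<le> L k - G k P" for P
      using kothe_norm_le_of_partial_sums(2)[OF b k tail[OF k]]
      by (subst kothe_norm_minus_commute)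
    then show "(\<lambda>P. kothe_norm b k (\<lambda>n. S P n - y n)) \<longlonglongrightarrow> 0"
      by (intro tendsto_sandwich[OF _ _ tendsto_const L0]) (auto simp: kothe_norm_nonneg[OF b k])
  qed
  ultimately show ?thesis unfolding S_def by blast
qed

section \<open>Precompact and bounded sets\<close>

lemma precompact_imp_kothe_bounded:
  assumes b: "kothe_matrix b" and S: "kothe_precompact b S"
  shows "kothe_bounded b S"
  unfolding kothe_bounded_def
proof (intro conjI allI impI)
  show "S \<subseteq> kothe_space b" using S by (simp add: kothe_precompact_def)
  fix k :: nat assume k: "1 \<le> k"
  let ?V = "kothe_ball b (\<lambda>_. 0) k 1"
  have "openin (kothe_topology b) ?V" "(\<lambda>_. 0) \<in> ?V"
    using k by (auto intro!: openin_kothe_ball centre_in_kothe_ball kothe_zero)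
  then obtain F where F: "finite F" "F \<subseteq> kothe_space b"
    "S \<subseteq> (\<Union>x\<in>F. {\<lambda>n. x n + v n | v. v \<in> ?V})"
    using S unfolding kothe_precompact_def by blast
  have "kothe_norm b k y \<le> Max (kothe_norm b k ` F) + 1" if y: "y \<in> S" for y
  proof -
    obtain x v where x: "x \<in> F" and v: "v \<in> ?V" and yxv: "y = (\<lambda>n. x n + v n)"
      using F(3) y by blast
    have "kothe_norm b k y \<le> kothe_norm b k x + kothe_norm b k v"
      unfolding yxv using kothe_add(2)[OF b _ _ k] x v F(2) by (auto simp: kothe_ball_def)
    moreover have "kothe_norm b k x \<le> Max (kothe_norm b k ` F)" using x F(1) by simp
    moreover have "kothe_norm b k v < 1" using v by (simp add: kothe_ball_def)
    ultimately show ?thesis by linarith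
  qed
  then show "bdd_above (kothe_norm b k ` S)" by (intro bdd_aboveI) auto
qed

text \<open>The Montel property gives a compact closure, and covering it by translates of a ball
  inside the given neighbourhood leaves finitely many of them.\<close>

lemma montel_bounded_imp_precompact:
  fixes S :: "(nat \<Rightarrow> 'a::{real_normed_field,heine_borel}) set"
  assumes b: "kothe_matrix b" and montel: "kothe_montel TYPE('a) b" and S: "kothe_bounded b S"
  shows "kothe_precompact b S"
  unfolding kothe_precompact_def
proof (intro conjI allI impI)
  show SK: "S \<subseteq> kothe_space b" using S by (simp add: kothe_bounded_def)
  let ?C = "kothe_topology b closure_of S"
  have compact: "compactin (kothe_topology b) ?C" using montel S by (simp add: kothe_montel_def)
  have CK: "?C \<subseteq> kothe_space b" using closure_of_subset_topspace topspace_kothe by metis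
  fix V :: "(nat \<Rightarrow> 'a) set" assume "openin (kothe_topology b) V \<and> (\<lambda>_. 0) \<in> V"
  then obtain k e where k: "1 \<le> k" "0 < e" and V: "kothe_ball b (\<lambda>_. 0) k e \<subseteq> V"
    using openin_kothe_contains_ball[OF b] by blast
  let ?\<U> = "(\<lambda>x. kothe_ball b x k e) ` kothe_space b"
  have "?C \<subseteq> \<Union>?\<U>" using CK centre_in_kothe_ball[OF _ k(2)] by blast
  moreover have "openin (kothe_topology b) U" if "U \<in> ?\<U>" for U
    using that openin_kothe_ball[OF _ k] by blast
  ultimately obtain \<F> where \<F>: "finite \<F>" "\<F> \<subseteq> ?\<U>" "?C \<subseteq> \<Union>\<F>"
    using compact[unfolded compactin_def, THEN conjunct2, rule_format, of ?\<U>] by blast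
  then obtain F where F: "F \<subseteq> kothe_space b" "finite F" "\<F> = (\<lambda>x. kothe_ball b x k e) ` F"
    by (meson finite_subset_image)
  have "S \<subseteq> (\<Union>x\<in>F. {\<lambda>n. x n + v n | v. v \<in> V})"
  proof
    fix y assume "y \<in> S"
    then have "y \<in> ?C" using SK closure_of_subset[of S "kothe_topology b"] topspace_kothe by blast
    then obtain x where x: "x \<in> F" "y \<in> kothe_ball b x k e" using \<F>(3) F(3) by blast
    then have "(\<lambda>n. y n - x n) \<in> kothe_ball b (\<lambda>_. 0) k e"
      using F(1) kothe_diff[OF b] by (auto simp: kothe_ball_def)
    then have "(\<lambda>n. y n - x n) \<in> V" using V by blast
    then have "y \<in> {\<lambda>n. x n + v n | v. v \<in> V}" by (intro CollectI exI[of _ "\<lambda>n. y n - x n"]) auto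
    then show "y \<in> (\<Union>x\<in>F. {\<lambda>n. x n + v n | v. v \<in> V})" using x by blast
  qed
  then show "\<exists>F. finite F \<and> F \<subseteq> kothe_space b \<and> S \<subseteq> (\<Union>x\<in>F. {\<lambda>n. x n + v n | v. v \<in> V})"
    using F by blast
qed

section \<open>Compactness in terms of the columns\<close>

lemma toeplitz_column_eq: "toeplitz_column \<theta> n i = (if i \<in> {1..n} then \<theta> (n - i) else 0)"
proof -
  have "toeplitz_column \<theta> n i = (\<Sum>j=1..n. if i = j then \<theta> (n - j) else 0)"
    unfolding toeplitz_column_def by (intro sum.cong) (auto simp: unit_seq_def)
  then show ?thesis by simp
qed

lemma toeplitz_column_in_kothe_space: "toeplitz_column \<theta> n \<in> kothe_space b"
  by (rule finite_support_in_kothe_space(1)[where n = n]) (auto simp: toeplitz_column_eq)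

lemma kothe_norm_toeplitz_column:
  "kothe_norm b k (toeplitz_column \<theta> n) = (\<Sum>j=1..n. norm (\<theta> (n - j)) * b j k)"
  by (subst finite_support_in_kothe_space(2)[where n = n]) (auto simp: toeplitz_column_eq)

lemma toeplitz_op_eqI:
  assumes b: "kothe_matrix b" and y: "toeplitz_sums b \<theta> x y"
  shows "toeplitz_op b \<theta> x = y"
  unfolding toeplitz_op_def
proof (rule the_equality[where P = "toeplitz_sums b \<theta> x", OF y])
  have s: "(\<lambda>i. \<Sum>n=1..N. x n * toeplitz_column \<theta> n i) \<in> kothe_space b" for N
    by (intro kothe_sum(1)[OF b] kothe_scale(1) toeplitz_column_in_kothe_space)
  show "z = y" if "toeplitz_sums b \<theta> x z" for z
    using kothe_limit_unique[OF b s _ that[unfolded toeplitz_sums_def] y[unfolded toeplitz_sums_def]]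
    by simp
qed

lemma toeplitz_op_scaled_unit:
  assumes b: "kothe_matrix b" and n: "1 \<le> n"
  shows "toeplitz_op b \<theta> (\<lambda>i. c * unit_seq n i) = (\<lambda>i. c * toeplitz_column \<theta> n i)"
proof (rule toeplitz_op_eqI[OF b])
  have "(\<Sum>m=1..N. c * unit_seq n m * toeplitz_column \<theta> m i) = c * toeplitz_column \<theta> n i"
    if "n \<le> N" for N i
  proof -
    have "(\<Sum>m=1..N. c * unit_seq n m * toeplitz_column \<theta> m i)
        = (\<Sum>m=1..N. if m = n then c * toeplitz_column \<theta> m i else 0)"
      by (intro sum.cong) (auto simp: unit_seq_def)
    then show ?thesis using n that by simp
  qed
  then have "\<forall>\<^sub>F N in sequentially.
      (\<lambda>i. \<Sum>m=1..N. c * unit_seq n m * toeplitz_column \<theta> m i) = (\<lambda>i. c * toeplitz_column \<theta> n i)"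
    by (auto simp: eventually_sequentially)
  then show "toeplitz_sums b \<theta> (\<lambda>i. c * unit_seq n i) (\<lambda>i. c * toeplitz_column \<theta> n i)"
    unfolding toeplitz_sums_def
    by (intro limitin_eventually)
      (simp_all add: topspace_kothe kothe_scale(1)[OF toeplitz_column_in_kothe_space])
qed

text \<open>The multiple of the \<open>n\<close>-th unit vector with \<open>m\<close>-th seminorm \<open>e / 2\<close> lies in the
  neighbourhood with precompact image, so the seminorms of its image are bounded uniformly in \<open>n\<close>.\<close>

lemma toeplitz_column_bound_of_compact:
  fixes \<theta> :: "nat \<Rightarrow> 'a::{real_normed_field,heine_borel}"
  assumes a: "kothe_matrix a" and a_pos: "\<And>n k. 1 \<le> n \<Longrightarrow> 1 \<le> k \<Longrightarrow> 0 < a n k"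
    and b: "kothe_matrix b" and compact: "toeplitz_compact a b \<theta>"
  shows "\<exists>m\<ge>1. \<forall>k\<ge>1. \<exists>C>0. \<forall>n\<ge>1. kothe_norm b k (toeplitz_column \<theta> n) \<le> C * a n m"
proof -
  obtain U where U: "openin (kothe_topology a) U" "(\<lambda>_. 0) \<in> U"
    and pre: "kothe_precompact b (toeplitz_op b \<theta> ` U)"
    using compact by (auto simp: toeplitz_compact_def kothe_compact_map_def)
  obtain m e where m: "1 \<le> m" and e: "0 < e" and ball: "kothe_ball a (\<lambda>_. 0) m e \<subseteq> U"
    using openin_kothe_contains_ball[OF a U] by blast
  have "\<exists>C>0. \<forall>n\<ge>1. kothe_norm b k (toeplitz_column \<theta> n) \<le> C * a n m" if k: "1 \<le> k" for k
  proof -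
    have "bdd_above (kothe_norm b k ` toeplitz_op b \<theta> ` U)"
      using precompact_imp_kothe_bounded[OF b pre] k by (simp add: kothe_bounded_def)
    then obtain R where R: "\<And>x. x \<in> U \<Longrightarrow> kothe_norm b k (toeplitz_op b \<theta> x) \<le> R"
      by (rule bdd_above.E) blast
    have R': "R \<ge> 0" using order_trans[OF kothe_norm_nonneg[OF b k] R[OF U(2)]] .
    \<comment> \<open>\<open>R\<close> may vanish, whereas the constant must be positive; hence \<open>R + 1\<close>.\<close>
    have "kothe_norm b k (toeplitz_column \<theta> n) \<le> (2 * (R + 1) / e) * a n m" if n: "1 \<le> n" for n
    proof -
      define c :: 'a where "c = of_real (e / (2 * a n m))"
      have an: "0 < a n m" by (rule a_pos[OF n m])
      have supp: "i \<notin> {1..n} \<Longrightarrow> unit_seq n i = (0::'a)" for i using n by (auto simp: unit_seq_def)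
      have "(\<Sum>i=1..n. norm (unit_seq n i :: 'a) * a i m) = (\<Sum>i=1..n. if i = n then a i m else 0)"
        by (intro sum.cong) (auto simp: unit_seq_def)
      then have unit: "kothe_norm a m (unit_seq n :: nat \<Rightarrow> 'a) = a n m"
        using finite_support_in_kothe_space(2)[OF supp] n by simp
      have unitK: "(unit_seq n :: nat \<Rightarrow> 'a) \<in> kothe_space a"
        by (rule finite_support_in_kothe_space(1)[OF supp])
      have "norm c = e / (2 * a n m)" using e an unfolding c_def norm_of_real by simp
      then have "kothe_norm a m (\<lambda>i. c * unit_seq n i) < e"
        using e an by (simp add: kothe_scale(2)[OF unitK] unit)
      then have "(\<lambda>i. c * unit_seq n i) \<in> kothe_ball a (\<lambda>_. 0) m e"
        using kothe_scale(1)[OF unitK, of c] by (simp add: kothe_ball_def)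
      from R[OF subsetD[OF ball this]]
      have "kothe_norm b k (\<lambda>i. c * toeplitz_column \<theta> n i) \<le> R"
        by (simp only: toeplitz_op_scaled_unit[OF b n])
      then have "e / (2 * a n m) * kothe_norm b k (toeplitz_column \<theta> n) \<le> R"
        unfolding kothe_scale(2)[OF toeplitz_column_in_kothe_space] \<open>norm c = _\<close> .
      then have "kothe_norm b k (toeplitz_column \<theta> n) \<le> (2 * R / e) * a n m"
        using e an by (simp add: field_simps)
      also have "\<dots> \<le> (2 * (R + 1) / e) * a n m"
        using e an by (simp add: field_simps)
      finally show ?thesis .
    qed
    moreover have "0 < 2 * (R + 1) / e" using R' e by simp
    ultimately show ?thesis by blast
  qed
  with m show ?thesis by blast
qed

text \<open>Since \<open>m\<close> is independent of \<open>k\<close>, the unit ball of a single seminorm of the domain has an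
  image that is bounded in all seminorms of the target.\<close>

lemma toeplitz_compact_of_column_bound:
  fixes \<theta> :: "nat \<Rightarrow> 'a::{real_normed_field,heine_borel}"
  assumes a: "kothe_matrix a" and b: "kothe_matrix b" and montel: "kothe_montel TYPE('a) b"
    and m: "1 \<le> m"
    and col: "\<And>k. 1 \<le> k \<Longrightarrow> \<exists>C>0. \<forall>n\<ge>1. kothe_norm b k (toeplitz_column \<theta> n) \<le> C * a n m"
  shows "toeplitz_compact a b \<theta>"
proof -
  obtain C where C: "\<And>k. 1 \<le> k \<Longrightarrow> 0 < C k"
    and le: "\<And>k n. 1 \<le> k \<Longrightarrow> 1 \<le> n \<Longrightarrow> kothe_norm b k (toeplitz_column \<theta> n) \<le> C k * a n m"
    using col by metis
  have sums: "\<exists>y. toeplitz_sums b \<theta> x y \<and> (\<forall>k\<ge>1. kothe_norm b k y \<le> C k * kothe_norm a m x)"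
    if x: "x \<in> kothe_space a" for x :: "nat \<Rightarrow> 'a"
    unfolding toeplitz_sums_def
  proof (rule kothe_series_convergent[OF b])
    show "(\<lambda>i. x n * toeplitz_column \<theta> n i) \<in> kothe_space b" for n
      by (intro kothe_scale(1) toeplitz_column_in_kothe_space)
    fix k N :: nat assume k: "1 \<le> k"
    have "(\<Sum>n=1..N. kothe_norm b k (\<lambda>i. x n * toeplitz_column \<theta> n i))
        \<le> (\<Sum>n=1..N. C k * (norm (x n) * a n m))"
    proof (rule sum_mono)
      fix n assume "n \<in> {1..N}"
      then have "norm (x n) * kothe_norm b k (toeplitz_column \<theta> n) \<le> norm (x n) * (C k * a n m)"
        using le[OF k, of n] by (intro mult_left_mono) auto
      then show "kothe_norm b k (\<lambda>i. x n * toeplitz_column \<theta> n i) \<le> C k * (norm (x n) * a n m)"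
        by (simp add: kothe_scale(2)[OF toeplitz_column_in_kothe_space] mult_ac)
    qed
    also have "\<dots> \<le> C k * kothe_norm a m x"
      unfolding sum_distrib_left[symmetric]
      using C[OF k] partial_sum_le_kothe_norm[OF a x m] by (intro mult_left_mono) auto
    finally show "(\<Sum>n=1..N. kothe_norm b k (\<lambda>i. x n * toeplitz_column \<theta> n i))
        \<le> C k * kothe_norm a m x" .
  qed
  have op: "toeplitz_op b \<theta> x \<in> kothe_space b"
      "1 \<le> k \<Longrightarrow> kothe_norm b k (toeplitz_op b \<theta> x) \<le> C k * kothe_norm a m x"
    if x: "x \<in> kothe_space a" for x :: "nat \<Rightarrow> 'a" and k
  proof -
    obtain y where y: "toeplitz_sums b \<theta> x y" "\<forall>k\<ge>1. kothe_norm b k y \<le> C k * kothe_norm a m x"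
      using sums[OF x] by blast
    then show "toeplitz_op b \<theta> x \<in> kothe_space b"
      "1 \<le> k \<Longrightarrow> kothe_norm b k (toeplitz_op b \<theta> x) \<le> C k * kothe_norm a m x"
      using toeplitz_op_eqI[OF b y(1)]
      by (auto simp: toeplitz_sums_def limitin_def topspace_kothe)
  qed
  let ?U = "kothe_ball a (\<lambda>_. 0) m 1 :: (nat \<Rightarrow> 'a) set"
  have "kothe_bounded b (toeplitz_op b \<theta> ` ?U)"
    unfolding kothe_bounded_def
  proof (intro conjI allI impI)
    show "toeplitz_op b \<theta> ` ?U \<subseteq> kothe_space b" using op(1) by (auto simp: kothe_ball_def)
    fix k :: nat assume k: "1 \<le> k"
    have "kothe_norm b k (toeplitz_op b \<theta> x) \<le> C k" if "x \<in> ?U" for x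
    proof -
      have "x \<in> kothe_space a" "kothe_norm a m x \<le> 1" using that by (auto simp: kothe_ball_def)
      then show ?thesis using op(2)[OF _ k, of x] C[OF k] mult_left_le[of "kothe_norm a m x" "C k"]
        by linarith
    qed
    then show "bdd_above (kothe_norm b k ` toeplitz_op b \<theta> ` ?U)" by (intro bdd_aboveI) auto
  qed
  then have "kothe_precompact b (toeplitz_op b \<theta> ` ?U)"
    by (rule montel_bounded_imp_precompact[OF b montel])
  moreover have "openin (kothe_topology a) ?U" "(\<lambda>_. 0) \<in> ?U"
    using m by (auto intro!: openin_kothe_ball centre_in_kothe_ball kothe_zero)
  moreover have "toeplitz_op b \<theta> ` kothe_space a \<subseteq> kothe_space b" using op(1) by blast
  ultimately have "kothe_compact_map a b (toeplitz_op b \<theta>)"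
    unfolding kothe_compact_map_def by blast
  moreover have "toeplitz_well_defined a b \<theta>"
    using sums unfolding toeplitz_well_defined_def by blast
  ultimately show ?thesis by (simp add: toeplitz_compact_def)
qed

section \<open>Power series spaces of infinite type\<close>

lemma exponent_seq_mono:
  assumes "exponent_seq \<alpha>" "1 \<le> i" "i \<le> j"
  shows "\<alpha> i \<le> \<alpha> j"
  using assms(3)
proof (induction j rule: dec_induct)
  case (step j)
  then have "\<alpha> j \<le> \<alpha> (Suc j)" using assms by (simp add: exponent_seq_def)
  with step.IH show ?case by linarith
qed simp

lemma kothe_power_series_matrix: "exponent_seq \<alpha> \<Longrightarrow> kothe_matrix (power_series_matrix \<alpha>)"
  by (auto simp: kothe_matrix_def power_series_matrix_def exponent_seq_def intro: mult_right_mono)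

text \<open>The terms of the convergent series \<open>\<Sum> e\<^bsup>-q \<alpha>\<^sub>n\<^esup>\<close> decrease, so \<open>n\<close> times the \<open>n\<close>-th term is at
  most the sum.\<close>

lemma index_le_exp_of_nuclear:
  assumes \<alpha>: "exponent_seq \<alpha>" and nuclear: "power_series_nuclear \<alpha>"
  shows "\<exists>q S. 0 < S \<and> (\<forall>n\<ge>1. real n \<le> S * exp (real q * \<alpha> n))"
proof -
  obtain l where l: "l > 1" and summ: "(\<lambda>n. exp ((real 1 - real l) * \<alpha> n)) summable_on {1..}"
    using nuclear unfolding power_series_nuclear_def by (metis order_refl)
  define q where "q = l - 1"
  have q: "(real 1 - real l) = - real q" using l by (simp add: q_def)
  define S where "S = (\<Sum>\<^sub>\<infinity>n\<in>{1..}. exp (- real q * \<alpha> n))"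
  have le: "real n \<le> S * exp (real q * \<alpha> n)" if "1 \<le> n" for n
  proof -
    have "real n * exp (- real q * \<alpha> n) = (\<Sum>i=1..n. exp (- real q * \<alpha> n))" by simp
    also have "\<dots> \<le> (\<Sum>i=1..n. exp (- real q * \<alpha> i))"
      using exponent_seq_mono[OF \<alpha>] by (intro sum_mono) (auto intro: mult_left_mono)
    also have "\<dots> \<le> S"
      unfolding S_def using summ[unfolded q] by (intro finite_sum_le_infsum) auto
    finally show ?thesis by (simp add: exp_minus field_simps)
  qed
  have "0 < S * exp (real q * \<alpha> 1)" using le[of 1] by simp
  then have "0 < S" by (simp add: zero_less_mult_iff)
  with le show ?thesis by blast
qed

theorem theorem4p4:
  fixes \<alpha> :: "nat \<Rightarrow> real"
    and b :: "nat \<Rightarrow> nat \<Rightarrow> real"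
    and \<theta> :: "nat \<Rightarrow> 'a::{real_normed_field,heine_borel}"
    and s0 :: nat
  assumes "exponent_seq \<alpha>"
    and "power_series_nuclear \<alpha>"
    and "kothe_matrix b"
    and "kothe_montel TYPE('a) b"
    and "infinite {t. \<theta> t \<noteq> 0}"
    and "s0 = (LEAST t. \<theta> t \<noteq> 0)"
  shows "toeplitz_compact (power_series_matrix \<alpha>) b \<theta> \<longleftrightarrow>
    shift_index \<theta> \<in> power_series_dual \<alpha> \<and>
    (\<exists>m\<ge>1. \<forall>k\<ge>1. \<exists>C>0. \<forall>n>s0. b (n - s0) k \<le> C * exp (real m * \<alpha> n))"
    (is "?compact \<longleftrightarrow> ?dual \<and> ?growth")
proof -
  note \<alpha> = assms(1) and b = assms(3) and a = kothe_power_series_matrix[OF assms(1)]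
  have "\<exists>t. \<theta> t \<noteq> 0" using assms(5) not_finite_existsD by auto
  then have s0: "\<theta> s0 \<noteq> 0"
    unfolding assms(6) by (rule LeastI_ex)
  have before: "\<theta> t = 0" if "t < s0" for t
    using not_less_Least[OF that[unfolded assms(6)]] by simp
  show ?thesis
  proof
    assume compact: ?compact
    have "0 < power_series_matrix \<alpha> n k" for n k by (simp add: power_series_matrix_def)
    from toeplitz_column_bound_of_compact[OF a this b compact] obtain m where m: "1 \<le> m" and col: "\<And>k. 1 \<le> k \<Longrightarrow>
        \<exists>C>0. \<forall>n\<ge>1. kothe_norm b k (toeplitz_column \<theta> n) \<le> C * exp (real m * \<alpha> n)"
      unfolding power_series_matrix_def by blast
    have coord: "norm (\<theta> (n - j)) * b j k \<le> C * exp (real m * \<alpha> n)"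
      if "1 \<le> k" "1 \<le> j" "j \<le> n"
        and "\<forall>n\<ge>1. kothe_norm b k (toeplitz_column \<theta> n) \<le> C * exp (real m * \<alpha> n)" for n j k C
    proof -
      have "norm (\<theta> (n - j)) * b j k \<le> kothe_norm b k (toeplitz_column \<theta> n)"
        using coordinate_le_kothe_norm[OF b toeplitz_column_in_kothe_space[of \<theta> n] that(1,2)] that(2,3)
        by (simp add: toeplitz_column_eq)
      also have "\<dots> \<le> C * exp (real m * \<alpha> n)" using that by auto
      finally show ?thesis .
    qed
    have ?dual
    proof -
      obtain k where k: "1 \<le> k" "0 < b 1 k" using kothe_weight_pos[OF b, of 1] by auto
      obtain C where C: "\<forall>n\<ge>1. kothe_norm b k (toeplitz_column \<theta> n) \<le> C * exp (real m * \<alpha> n)"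
        using col[OF k(1)] by blast
      have "norm (shift_index \<theta> n) * exp (- (real m * \<alpha> n)) \<le> C / b 1 k" if "1 \<le> n" for n
        using coord[OF k(1) _ that C] that k(2) by (simp add: shift_index_def exp_minus field_simps)
      then have "bdd_above ((\<lambda>n. norm (shift_index \<theta> n) * exp (- (real m * \<alpha> n))) ` {1..})"
        by (intro bdd_aboveI) auto
      then show ?thesis using m by (auto simp: power_series_dual_def shift_index_def)
    qed
    moreover have ?growth
    proof (intro exI[of _ m] conjI m allI impI)
      fix k :: nat assume k: "1 \<le> k"
      obtain C where C: "0 < C"
        "\<forall>n\<ge>1. kothe_norm b k (toeplitz_column \<theta> n) \<le> C * exp (real m * \<alpha> n)"
        using col[OF k] by blast
      have "b (n - s0) k \<le> C / norm (\<theta> s0) * exp (real m * \<alpha> n)" if "n > s0" for n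
        using coord[OF k _ _ C(2), of "n - s0" n] that s0 by (simp add: field_simps)
      moreover have "0 < C / norm (\<theta> s0)" using C(1) s0 by simp
      ultimately show "\<exists>C>0. \<forall>n>s0. b (n - s0) k \<le> C * exp (real m * \<alpha> n)" by blast
    qed
    ultimately show "?dual \<and> ?growth" ..
  next
    assume R: "?dual \<and> ?growth"
    then obtain p D where D: "\<And>n. 1 \<le> n \<Longrightarrow> norm (\<theta> (n - 1)) * exp (- (real p * \<alpha> n)) \<le> D"
      by (force simp: power_series_dual_def shift_index_def bdd_above_def)
    obtain m where m: "1 \<le> m"
      and growth: "\<And>k. 1 \<le> k \<Longrightarrow> \<exists>C>0. \<forall>n>s0. b (n - s0) k \<le> C * exp (real m * \<alpha> n)"
      using R by blast
    obtain q S where S: "0 < S" and index: "\<And>n. 1 \<le> n \<Longrightarrow> real n \<le> S * exp (real q * \<alpha> n)"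
      using index_le_exp_of_nuclear[OF \<alpha> assms(2)] by blast
    have D0: "0 \<le> D" using D[of 1] by (meson order_refl norm_ge_zero exp_ge_zero mult_nonneg_nonneg order_trans)
    \<comment> \<open>The dual condition pairs \<open>\<theta>\<^sub>t\<close> with \<open>\<alpha>\<close> at \<open>t + 1\<close>, which is still at most \<open>n\<close>.\<close>
    have theta: "norm (\<theta> t) \<le> D * exp (real p * \<alpha> n)" if "t < n" for t n
    proof -
      have "norm (\<theta> t) \<le> D * exp (real p * \<alpha> (Suc t))"
        using D[of "Suc t"] by (simp add: exp_minus field_simps)
      also have "\<dots> \<le> D * exp (real p * \<alpha> n)"
        using exponent_seq_mono[OF \<alpha>, of "Suc t" n] that D0 by (intro mult_left_mono) (auto intro: mult_left_mono)
      finally show ?thesis .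
    qed
    have "\<exists>C>0. \<forall>n\<ge>1. kothe_norm b k (toeplitz_column \<theta> n)
        \<le> C * power_series_matrix \<alpha> n (p + m + q)" if k: "1 \<le> k" for k
    proof -
      obtain C where C: "0 < C" "\<And>n. n > s0 \<Longrightarrow> b (n - s0) k \<le> C * exp (real m * \<alpha> n)"
        using growth[OF k] by blast
      have "kothe_norm b k (toeplitz_column \<theta> n)
          \<le> ((D + 1) * C * S) * power_series_matrix \<alpha> n (p + m + q)" if n: "1 \<le> n" for n
      proof -
        let ?E = "exp (real p * \<alpha> n) * exp (real m * \<alpha> n)"
        have summand: "norm (\<theta> (n - j)) * b j k \<le> D * C * ?E" if j: "j \<in> {1..n}" for j
        \<comment> \<open>Either \<open>\<theta>\<close> vanishes at \<open>n - j\<close>, or \<open>j + s0 \<le> n\<close>, so that the growth condition at index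
          \<open>j + s0\<close> yields a bound in terms of \<open>\<alpha> n\<close>.\<close>
        proof (cases "n - j < s0")
          case True
          then show ?thesis using before[of "n - j"] D0 C(1) by simp
        next
          case False
          have bj: "b j k \<le> C * exp (real m * \<alpha> n)"
          proof -
            have "b j k \<le> C * exp (real m * \<alpha> (j + s0))" using C(2)[of "j + s0"] j by simp
            also have "\<dots> \<le> C * exp (real m * \<alpha> n)"
              using exponent_seq_mono[OF \<alpha>, of "j + s0" n] j False C(1)
              by (intro mult_left_mono) (auto intro: mult_left_mono)
            finally show ?thesis .
          qed
          have "norm (\<theta> (n - j)) * b j k \<le> (D * exp (real p * \<alpha> n)) * (C * exp (real m * \<alpha> n))"
            using theta[of "n - j" n] bj j D0 kothe_weight_nonneg[OF b _ k, of j]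
            by (intro mult_mono) auto
          then show ?thesis by (simp add: mult_ac)
        qed
        have "kothe_norm b k (toeplitz_column \<theta> n) \<le> real n * (D * C * ?E)"
          unfolding kothe_norm_toeplitz_column
          using sum_bounded_above[of "{1..n}" "\<lambda>j. norm (\<theta> (n - j)) * b j k" "D * C * ?E", OF summand] by simp
        also have "\<dots> \<le> (S * exp (real q * \<alpha> n)) * (D * C * ?E)"
          using index[OF n] D0 C(1) by (intro mult_right_mono) auto
        also have "\<dots> = (D * C * S) * power_series_matrix \<alpha> n (p + m + q)"
          by (simp add: power_series_matrix_def ring_distribs exp_add mult_ac)
        also have "\<dots> \<le> ((D + 1) * C * S) * power_series_matrix \<alpha> n (p + m + q)"
          using C(1) S by (intro mult_right_mono) (auto simp: power_series_matrix_def)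
        finally show ?thesis .
      qed
      moreover have "0 < (D + 1) * C * S" using D0 C(1) S by simp
      ultimately show ?thesis by blast
    qed
    then show ?compact
      using m by (intro toeplitz_compact_of_column_bound[OF a b assms(4), of "p + m + q"]) auto
  qed
qed

end
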